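(* Let $s,m$ be positive integers and let $\delta\in(0,1/2]$. Set $d=\gcd(s,m)$ and $\hat m=m/d$. Then, for any $t\in\mathbb{R}$, $$\sum_{i=0}^{m-1}\mathrm{safe}\left(s,\delta,t+\frac{i}{m}\right)=m(1-2\delta)+d\,\mathrm{sgn}(\langle \hat m\delta\rangle)\Big(\mathrm{safe}\big(\mathrm{lcm}(s,m),\|\hat m\delta\|,t\big)-1+2\|\hat m\delta\|\Big).$$
   Context: For $x\in\mathbb{R}$, $\|x\|:=\min_{n\in\mathbb{Z}}|x-n|$ is the distance from $x$ to the nearest integer, and $\langle x\rangle$ is the centered fractional part of $x$: the unique representative of $x$ modulo $1$ lying in $(-1/2,1/2]$ (so $|\langle x\rangle|=\|x\|$). The sign function satisfies $\mathrm{sgn}(y)=1$ for $y>0$, $\mathrm{sgn}(y)=-1$ for $y<0$, and $\mathrm{sgn}(0)=0$. For a positive integer $s$, a real $t$, and $0<\delta<1/2$, the midpoint-valued safe function is $$\mathrm{safe}(s,\delta,t)=\begin{cases}1,&\text{if }\|st\|>\delta,\\ \tfrac12,&\text{if }\|st\|=\delta,\\ 0,&\text{if }\|st\|<\delta.\end{cases}$$ At the endpoints, by convention, $\mathrm{safe}(s,0,t)=1$ and $\mathrm{safe}(s,1/2,t)=0$ for all $s$ and $t$. *)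

theory Defs
  imports Complex_Main
begin

definition dist_int :: "real \<Rightarrow> real" where
  "dist_int x = (INF n::int. \<bar>x - of_int n\<bar>)"

lemma dist_int_round: "dist_int x = \<bar>x - of_int (round x)\<bar>"
  unfolding dist_int_def
proof (rule cInf_eq_minimum)
  show "\<bar>x - of_int (round x)\<bar> \<in> range (\<lambda>n::int. \<bar>x - of_int n\<bar>)"
    by blast
next
  fix y assume "y \<in> range (\<lambda>n::int. \<bar>x - of_int n\<bar>)"
  then obtain n :: int where "y = \<bar>x - of_int n\<bar>"
    by blast
  then show "\<bar>x - of_int (round x)\<bar> \<le> y"
    using round_diff_minimal[of x n] by simp
qed

text \<open>The infimum is attained, so it is the minimum over all integers.\<close>

lemma dist_int_attained:
  "\<exists>n::int. dist_int x = \<bar>x - of_int n\<bar> \<and> (\<forall>k::int. \<bar>x - of_int n\<bar> \<le> \<bar>x - of_int k\<bar>)"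
  using dist_int_round round_diff_minimal by blast

definition cfrac_part :: "real \<Rightarrow> real" where
  "cfrac_part x = (THE r. - 1/2 < r \<and> r \<le> 1/2 \<and> x - r \<in> \<int>)"

lemma cfrac_part_ex1: "\<exists>!r::real. - 1/2 < r \<and> r \<le> 1/2 \<and> x - r \<in> \<int>"
proof (rule ex1I)
  show "- 1/2 < x - of_int \<lceil>x - 1/2\<rceil> \<and> x - of_int \<lceil>x - 1/2\<rceil> \<le> 1/2 \<and>
        x - (x - of_int \<lceil>x - 1/2\<rceil>) \<in> \<int>"
    using ceiling_correct[of "x - 1/2"] by (intro conjI; (linarith | simp))
next
  fix r :: real assume r: "- 1/2 < r \<and> r \<le> 1/2 \<and> x - r \<in> \<int>"
  then obtain k :: int where k: "x - r = of_int k"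
    by (auto elim: Ints_cases)
  have "\<lceil>x - 1/2\<rceil> = k"
    by (rule ceiling_unique) (use r k in auto)
  then show "r = x - of_int \<lceil>x - 1/2\<rceil>"
    using k by simp
qed

text \<open>Only \<open>\<delta> \<in> {0..1/2}\<close> is meaningful; the endpoint values are conventions, and they
  differ from what the generic formula gives when \<open>dist_int (s * t) = \<delta>\<close>.\<close>

definition safe :: "nat \<Rightarrow> real \<Rightarrow> real \<Rightarrow> real" where
  "safe s \<delta> t =
    (if \<delta> = 0 then 1
     else if \<delta> = 1/2 then 0
     else if dist_int (real s * t) > \<delta> then 1
     else if dist_int (real s * t) = \<delta> then 1/2
     else 0)"

end

theory Submission
  imports Defs
begin

text \<open>
  Everything reduces to the sawtooth function \<open>saw\<close>, whose value is the fractional part minus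
  one half off the integers and \<open>0\<close> at the integers. For \<open>0 < \<delta> < 1/2\<close>, the quantity
  \<open>1 - safe s \<delta> t\<close> counts the integers in the interval of radius \<open>\<delta>\<close> about \<open>s * t\<close>, with
  weight one half at the ends of the interval. The function \<open>x - saw x\<close> jumps by one at each
  integer, takes the midpoint value there and is constant in between. The count is therefore a
  difference of two of its values, which gives
  \<open>safe s \<delta> t = 1 - 2 * \<delta> + saw (s * t + \<delta>) - saw (s * t - \<delta>)\<close>
  (lemma \<open>safe_eq_saw\<close>). The conventions at \<open>\<delta> = 0\<close> and \<open>\<delta> = 1/2\<close> are the values that this
  identity prescribes, so no endpoint needs separate treatment afterwards.

  The sawtooth function is periodic and satisfies a distribution relation: the sum of
  \<open>saw (x + a * i / n)\<close> over a full residue system is \<open>saw (n * x)\<close> whenever \<open>a\<close> is coprime to \<open>n\<close>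
  (lemma \<open>sum_saw_coprime\<close>). With \<open>d = gcd s m\<close> and \<open>n = m / d\<close>, the points \<open>s * i / m\<close> for
  \<open>i < m\<close> run \<open>d\<close> times through the multiples of \<open>1 / n\<close> modulo \<open>1\<close>. Hence the sum of the safe
  values is \<open>m * (1 - 2 * \<delta>) + d * (saw (L * t + n * \<delta>) - saw (L * t - n * \<delta>))\<close>, where
  \<open>L = n * s = lcm s m\<close>. By periodicity \<open>n * \<delta>\<close> may be replaced by its centered fractional part
  \<open>r\<close>. The difference is odd in \<open>r\<close>, so it is \<open>sgn r\<close> times its value at \<open>\<bar>r\<bar>\<close>, the distance
  from \<open>n * \<delta>\<close> to the nearest integer, and the first identity read backwards turns that value
  into a safe value again.
\<close>

definition saw :: "real \<Rightarrow> real" where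
  "saw x = x - (of_int \<lfloor>x\<rfloor> + of_int \<lceil>x\<rceil>) / 2"

lemma saw_add_int [simp]: "saw (x + of_int k) = saw x"
  by (simp add: saw_def field_simps)

lemma saw_diff_int [simp]: "saw (x - of_int k) = saw x"
  using saw_add_int[of x "- k"] by simp

lemma saw_0 [simp]: "saw 0 = 0"
  by (simp add: saw_def)

lemma saw_pos: "0 < x \<Longrightarrow> x < 1 \<Longrightarrow> saw x = x - 1/2"
proof -
  assume "0 < x" "x < 1"
  then have "\<lfloor>x\<rfloor> = 0" "\<lceil>x\<rceil> = 1"
    by linarith+
  then show ?thesis
    by (simp add: saw_def)
qed

lemma saw_neg: "- 1 < x \<Longrightarrow> x < 0 \<Longrightarrow> saw x = x + 1/2"
  using saw_pos[of "x + 1"] saw_add_int[of x 1] by simp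

text \<open>
  Modulo \<open>1\<close> the points \<open>x + a * i / n\<close> are the translates by multiples of \<open>1 / n\<close> of a single
  point \<open>y\<close> in \<open>[0, 1/n)\<close>, each translate occurring once because \<open>a\<close> is invertible modulo \<open>n\<close>.
  All of these translates lie in \<open>[0, 1)\<close>, where \<open>saw\<close> is given by a formula.
\<close>

lemma sum_saw_coprime:
  fixes a n :: nat
  assumes n: "n > 0" and cop: "coprime a n"
  shows "(\<Sum>i<n. saw (x + real a * real i / real n)) = saw (real n * x)"
proof -
  define k where "k = \<lfloor>real n * x\<rfloor>"
  define y where "y = (real n * x - of_int k) / real n"
  have nx: "real n * x = real n * y + of_int k"
    using n by (simp add: y_def)
  have y0: "0 \<le> y" and y1: "real n * y < 1"
    using n by (simp_all add: y_def k_def) linarith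
  define h where "h i = nat ((k + int a * int i) mod int n)" for i
  have h_eq: "int (h i) = (k + int a * int i) mod int n" for i
    using n by (simp add: h_def)
  have "inj_on h {..<n}"
  proof (rule inj_onI)
    fix i j assume ij: "i \<in> {..<n}" "j \<in> {..<n}" "h i = h j"
    then have "(k + int a * int i) mod int n = (k + int a * int j) mod int n"
      using h_eq by metis
    then have "int n dvd int a * (int i - int j)"
      by (simp add: mod_eq_dvd_iff algebra_simps)
    moreover have "coprime (int n) (int a)"
      using cop by (simp add: coprime_commute)
    ultimately have "int n dvd int i - int j"
      by (simp add: coprime_dvd_mult_right_iff)
    then have "int i mod int n = int j mod int n"
      by (simp add: mod_eq_dvd_iff)
    then show "i = j"
      using ij by simp
  qed
  moreover have "h ` {..<n} \<subseteq> {..<n}"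
    using n by (auto simp: h_def nat_less_iff)
  ultimately have bij: "bij_betw h {..<n} {..<n}"
    by (simp add: bij_betw_def endo_inj_surj)
  have shift: "saw (x + real a * real i / real n) = saw (y + real (h i) / real n)" for i
  proof -
    define q where "q = (k + int a * int i) div int n"
    have "k + int a * int i = int n * q + int (h i)"
      by (simp add: h_eq q_def)
    then have "real_of_int k + real a * real i = real n * of_int q + real (h i)"
      by (metis of_int_add of_int_mult of_int_of_nat_eq)
    then have "x + real a * real i / real n = y + real (h i) / real n + of_int q"
      using n by (simp add: y_def field_simps)
    then show ?thesis
      by simp
  qed
  have "(\<Sum>i<n. saw (x + real a * real i / real n)) = (\<Sum>j<n. saw (y + real j / real n))"
    unfolding shift by (rule sum.reindex_bij_betw[OF bij])
  also have "\<dots> = (\<Sum>j<n. y + real j / real n - 1/2 + (if j = 0 \<and> y = 0 then 1/2 else 0))"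
  proof (rule sum.cong[OF refl])
    fix j assume "j \<in> {..<n}"
    then have "real j + 1 \<le> real n"
      by simp
    then have "real n * y + real j < real n"
      using y1 by linarith
    then have lt: "y + real j / real n < 1"
      using n by (simp add: field_simps)
    show "saw (y + real j / real n)
        = y + real j / real n - 1/2 + (if j = 0 \<and> y = 0 then 1/2 else 0)"
    proof (cases "j = 0 \<and> y = 0")
      case False
      then have "0 < y + real j / real n"
        using y0 n by (cases "j = 0") (auto intro: add_nonneg_pos)
      with lt False show ?thesis
        by (auto simp: saw_pos)
    qed simp
  qed
  also have "\<dots> = saw (real n * y)"
  proof -
    have gauss: "(\<Sum>j<n. real j) = real n * (real n - 1) / 2"
      by (induction n) (simp_all add: field_simps)
    have corr: "(\<Sum>j<n. if j = 0 \<and> y = 0 then 1/2 else 0) = (if y = 0 then 1/2 else (0::real))"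
      using n by (auto simp: sum.delta)
    have "(\<Sum>j<n. y + real j / real n - 1/2 + (if j = 0 \<and> y = 0 then 1/2 else 0))
        = real n * y + (real n - 1) / 2 - real n / 2 + (if y = 0 then 1/2 else 0)"
      unfolding sum.distrib sum_subtractf corr sum_divide_distrib[symmetric] gauss
      using n by simp
    also have "\<dots> = saw (real n * y)"
      using n y0 y1 by (auto simp: saw_pos field_simps)
    finally show ?thesis .
  qed
  also have "\<dots> = saw (real n * x)"
    by (simp add: nx)
  finally show ?thesis .
qed

lemma sum_periodic_blocks:
  fixes f :: "nat \<Rightarrow> real"
  assumes "\<And>i. f (i + n) = f i"
  shows "(\<Sum>i<d * n. f i) = real d * (\<Sum>i<n. f i)"
proof (induction d)
  case (Suc d)
  have per: "f (i + e * n) = f i" for i e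
  proof (induction e)
    case (Suc e)
    then show ?case
      using assms[of "i + e * n"] by (simp add: algebra_simps)
  qed simp
  have "(\<Sum>i<Suc d * n. f i) = (\<Sum>i<d * n. f i) + (\<Sum>i=d * n..<d * n + n. f i)"
    using sum.atLeastLessThan_concat[of 0 "d * n" "d * n + n" f]
    by (simp add: atLeast0LessThan add.commute)
  also have "(\<Sum>i=d * n..<d * n + n. f i) = (\<Sum>i<n. f i)"
    using sum.shift_bounds_nat_ivl[of f 0 "d * n" n]
    by (simp add: atLeast0LessThan per add.commute)
  finally show ?case
    using Suc by (simp add: algebra_simps)
qed simp

text \<open>
  Dividing \<open>s / m\<close> by the common factor leaves a reduced fraction with denominator \<open>m / gcd s m\<close>,
  which is therefore the period of the summand.
\<close>

lemma sum_saw_multiples: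
  fixes s m :: nat
  assumes m: "m > 0"
  shows "(\<Sum>i<m. saw (x + real s * real i / real m))
    = real (gcd s m) * saw (real (m div gcd s m) * x)"
proof -
  define d where "d = gcd s m"
  define a where "a = s div d"
  define n where "n = m div d"
  have d: "d > 0"
    using m by (simp add: d_def)
  have s_eq: "s = d * a" and m_eq: "m = d * n"
    by (simp_all add: a_def n_def d_def)
  have n: "n > 0"
    using m m_eq by (cases n) auto
  have cop: "coprime a n"
    unfolding a_def n_def d_def using m by (intro div_gcd_coprime) simp
  define f where "f i = saw (x + real a * real i / real n)" for i
  have "f (i + n) = f i" for i
  proof -
    have "x + real a * real (i + n) / real n = x + real a * real i / real n + of_int (int a)"
      using n by (simp add: field_simps)
    then show ?thesis
      unfolding f_def by (metis saw_add_int)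
  qed
  then have "(\<Sum>i<d * n. f i) = real d * (\<Sum>i<n. f i)"
    by (rule sum_periodic_blocks)
  moreover have "saw (x + real s * real i / real m) = f i" for i
    using d by (simp add: f_def s_eq m_eq)
  moreover have "(\<Sum>i<n. f i) = saw (real n * x)"
    unfolding f_def by (rule sum_saw_coprime[OF n cop])
  ultimately show ?thesis
    by (simp add: m_eq[symmetric] d_def[symmetric] n_def[symmetric])
qed

text \<open>
  Both sides are \<open>1\<close>-periodic in \<open>s * t\<close>, so \<open>s * t\<close> may be replaced by its signed distance \<open>u\<close>
  from a nearest integer, and for \<open>\<delta> < 1/2\<close> the points \<open>u \<plusminus> \<delta>\<close> lie strictly between \<open>-1\<close> and
  \<open>1\<close>. At \<open>\<delta> = 0\<close> the two sawtooth values coincide, and at \<open>\<delta> = 1/2\<close> they coincide by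
  periodicity, which yields the conventional values.
\<close>

lemma safe_eq_saw:
  assumes "0 \<le> \<delta>" and "\<delta> \<le> 1/2"
  shows "safe s \<delta> t = 1 - 2 * \<delta> + saw (real s * t + \<delta>) - saw (real s * t - \<delta>)"
proof -
  define u where "u = real s * t - of_int (round (real s * t))"
  have st: "real s * t = u + of_int (round (real s * t))"
    by (simp add: u_def)
  have plus: "saw (real s * t + \<delta>) = saw (u + \<delta>)"
    by (subst st) (metis add.assoc add.commute saw_add_int)
  have minus: "saw (real s * t - \<delta>) = saw (u - \<delta>)"
    by (subst st) (metis add_diff_eq diff_add_eq saw_add_int)
  have u: "\<bar>u\<bar> \<le> 1/2"
    using of_int_round_abs_le[of "real s * t"] by (simp add: u_def abs_minus_commute)
  have dist: "dist_int (real s * t) = \<bar>u\<bar>"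
    by (simp add: dist_int_round u_def)
  consider "\<delta> = 0" | "\<delta> = 1/2" | "0 < \<delta>" "\<delta> < 1/2"
    using assms by linarith
  then show ?thesis
  proof cases
    case 1
    then show ?thesis
      by (simp add: safe_def)
  next
    case 2
    then show ?thesis
      unfolding 2 using saw_add_int[of "real s * t - 1/2" 1] by (simp add: safe_def add.commute)
  next
    case 3
    consider "u > \<delta>" | "u < - \<delta>" | "u = \<delta>" | "u = - \<delta>" | "- \<delta> < u" "u < \<delta>"
      by linarith
    then show ?thesis
      unfolding plus minus safe_def dist
      by cases (use 3 u in \<open>auto simp: saw_pos saw_neg\<close>)
  qed
qed

lemma cfrac_part_props:
  "- 1/2 < cfrac_part x" "cfrac_part x \<le> 1/2" "x - cfrac_part x \<in> \<int>"
  using theI'[OF cfrac_part_ex1[of x]] by (simp_all add: cfrac_part_def)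

lemma dist_int_eq_abs_cfrac_part: "dist_int x = \<bar>cfrac_part x\<bar>"
proof -
  obtain k where k: "x - cfrac_part x = of_int k"
    using cfrac_part_props(3) by (auto elim: Ints_cases)
  have "\<bar>cfrac_part x\<bar> \<le> \<bar>x - of_int n\<bar>" for n
  proof (cases "n = k")
    case False
    then have "1 \<le> \<bar>k - n\<bar>"
      by simp
    then have "1 \<le> \<bar>real_of_int k - real_of_int n\<bar>"
      by linarith
    then show ?thesis
      using k cfrac_part_props[of x] by linarith
  qed (use k in simp)
  moreover have "\<bar>cfrac_part x\<bar> = \<bar>x - of_int k\<bar>"
    using k by simp
  ultimately show ?thesis
    unfolding dist_int_def by (intro cInf_eq_minimum) auto
qed

theorem lemma3p1:
  fixes s m d mhat :: nat and \<delta> t :: real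
  assumes "s > 0" and "m > 0"
    and "0 < \<delta>" and "\<delta> \<le> 1/2"
    and "d = gcd s m" and "mhat = m div d"
  shows "(\<Sum>i<m. safe s \<delta> (t + real i / real m)) =
    real m * (1 - 2 * \<delta>) +
    real d * sgn (cfrac_part (real mhat * \<delta>)) *
      (safe (lcm s m) (dist_int (real mhat * \<delta>)) t - 1 + 2 * dist_int (real mhat * \<delta>))"
proof -
  define r where "r = cfrac_part (real mhat * \<delta>)"
  define X where "X = real (lcm s m) * t"
  have "lcm s m = mhat * s"
    using assms by (simp add: lcm_nat_def div_mult_swap mult.commute)
  then have X: "X = real mhat * (real s * t)"
    by (simp add: X_def)
  have "(\<Sum>i<m. safe s \<delta> (t + real i / real m))
    = (\<Sum>i<m. 1 - 2 * \<delta> + saw ((real s * t + \<delta>) + real s * real i / real m)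
        - saw ((real s * t - \<delta>) + real s * real i / real m))"
    using assms by (intro sum.cong refl) (simp add: safe_eq_saw algebra_simps)
  also have "\<dots> = real m * (1 - 2 * \<delta>)
      + real d * (saw (X + real mhat * \<delta>) - saw (X - real mhat * \<delta>))"
    unfolding sum.distrib sum_subtractf sum_saw_multiples[OF \<open>m > 0\<close>] X
    using assms by (simp add: algebra_simps)
  also have "saw (X + real mhat * \<delta>) - saw (X - real mhat * \<delta>) = saw (X + r) - saw (X - r)"
  proof -
    obtain k where k: "real mhat * \<delta> = r + of_int k"
      using cfrac_part_props(3)[of "real mhat * \<delta>"]
      by (auto simp: r_def diff_eq_eq add.commute elim!: Ints_cases)
    have "saw (X + real mhat * \<delta>) = saw (X + r)"
      unfolding k by (simp flip: add.assoc)
    moreover have "saw (X - real mhat * \<delta>) = saw (X - r)"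
      unfolding k by (simp flip: diff_diff_eq)
    ultimately show ?thesis
      by simp
  qed
  also have "\<dots> = sgn r * (saw (X + \<bar>r\<bar>) - saw (X - \<bar>r\<bar>))"
    by (auto simp: sgn_if abs_if)
  also have "saw (X + \<bar>r\<bar>) - saw (X - \<bar>r\<bar>) = safe (lcm s m) \<bar>r\<bar> t - 1 + 2 * \<bar>r\<bar>"
  proof -
    have "\<bar>r\<bar> \<le> 1/2"
      using cfrac_part_props[of "real mhat * \<delta>"] by (simp add: r_def)
    then show ?thesis
      by (simp add: safe_eq_saw X_def)
  qed
  finally show ?thesis
    by (simp add: dist_int_eq_abs_cfrac_part r_def mult.assoc)
qed

end
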